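(* For $i=1,2$ let $G_i$ and $H_i$ be $r_i$-regular graphs. If $G_1$ and $H_1$ are cospectral, and $G_2$ and $H_2$ are cospectral and non-isomorphic, then $G_1\veebar G_2$ and $H_1\veebar H_2$ are $\{A,L,Q,\mathcal L\}$NICS.
   Context: Graphs are finite, undirected and simple. $A(G)$ is the adjacency matrix, $D(G)$ the diagonal degree matrix, $L(G)=D(G)-A(G)$ the Laplacian, $Q(G)=D(G)+A(G)$ the signless Laplacian, and $\mathcal L(G)=I-D(G)^{-1/2}A(G)D(G)^{-1/2}$ the normalized Laplacian (with the convention that for a vertex of degree $0$ one sets $d_i^{-1/2}=0$ and the corresponding diagonal entry of $\mathcal L(G)$ is $0$). For $X\in\{A,L,Q,\mathcal L\}$ two graphs are $X$-cospectral if $X(\cdot)$ has the same eigenvalues with multiplicities for both. For $S\subseteq\{A,L,Q,\mathcal L\}$, two graphs are $S$NICS if they are non-isomorphic and $X$-cospectral for every $X\in S$. Two regular graphs are called cospectral if they are $X$-cospectral for any (equivalently, all) $X\in\{A,L,Q,\mathcal L\}$. For vertex-disjoint graphs $G_1$ (with $V(G_1)=\{u_1,\dots,u_{n_1}\}$) and $G_2$, the join $G_1\vee G_2$ is the disjoint union together with all edges between $V(G_1)$ and $V(G_2)$. The NS (Neighbors Splitting) join $G_1\veebar G_2$ is obtained from $G_1\vee G_2$ by adding new vertices $u_1',\dots,u_{n_1}'$ and joining $u_i'$ to $u_j$ if and only if $u_iu_j\in E(G_1)$. *)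

theory Defs
  imports
    "Graph_Theory.Pair_Digraph"
    "Graph_Theory.Digraph_Isomorphism"
    "Jordan_Normal_Form.Char_Poly"
    "HOL-Combinatorics.Permutations"
begin

text \<open>
  A finite simple graph is a \<^locale>\<open>pair_graph\<close>: finitely many vertices and a symmetric irreflexive
  set of arcs, an edge \<open>uv\<close> being the pair of arcs \<open>(u, v)\<close> and \<open>(v, u)\<close>. The null graph is allowed.
  The degree of \<open>v\<close> is its \<^const>\<open>out_degree\<close>, and \<^const>\<open>digraph_iso\<close> is graph isomorphism.
\<close>

definition regular :: "nat \<Rightarrow> 'a pair_pre_digraph \<Rightarrow> bool" where
  "regular r G \<longleftrightarrow> (\<forall>v \<in> pverts G. out_degree (with_proj G) v = r)"

text \<open>Matrices are taken with respect to an enumeration \<open>vs\<close> of the vertices.\<close>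

definition adj_matrix :: "'a pair_pre_digraph \<Rightarrow> 'a list \<Rightarrow> real mat" where
  "adj_matrix G vs = mat (length vs) (length vs)
     (\<lambda>(i, j). if (vs ! i, vs ! j) \<in> parcs G then 1 else 0)"

definition degree_diag :: "(nat \<Rightarrow> real) \<Rightarrow> 'a pair_pre_digraph \<Rightarrow> 'a list \<Rightarrow> real mat" where
  "degree_diag f G vs = mat (length vs) (length vs)
     (\<lambda>(i, j). if i = j then f (out_degree (with_proj G) (vs ! i)) else 0)"

datatype matrix_kind = Adjacency | Laplacian | Signless_Laplacian | Normalized_Laplacian

text \<open>
  In the normalized Laplacian, isolated vertices contribute the entry 0 both to \<open>D\<^sup>-\<^sup>1\<^sup>/\<^sup>2\<close> and to the
  diagonal matrix that replaces the identity, so that their diagonal entry is 0.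
\<close>

fun graph_matrix :: "matrix_kind \<Rightarrow> 'a pair_pre_digraph \<Rightarrow> 'a list \<Rightarrow> real mat" where
  "graph_matrix Adjacency G vs = adj_matrix G vs"
| "graph_matrix Laplacian G vs = degree_diag real G vs - adj_matrix G vs"
| "graph_matrix Signless_Laplacian G vs = degree_diag real G vs + adj_matrix G vs"
| "graph_matrix Normalized_Laplacian G vs =
     (let S = degree_diag (\<lambda>d. if d = 0 then 0 else 1 / sqrt (real d)) G vs
      in degree_diag (\<lambda>d. if d = 0 then 0 else 1) G vs - S * adj_matrix G vs * S)"

definition eigenvalue_mset :: "real mat \<Rightarrow> complex multiset" where
  "eigenvalue_mset M = proots (char_poly (map_mat complex_of_real M))"

definition spectrum :: "matrix_kind \<Rightarrow> 'a pair_pre_digraph \<Rightarrow> complex multiset" where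
  "spectrum X G = eigenvalue_mset (graph_matrix X G (SOME vs. distinct vs \<and> set vs = pverts G))"

definition cospectral_wrt ::
    "matrix_kind \<Rightarrow> 'a pair_pre_digraph \<Rightarrow> 'b pair_pre_digraph \<Rightarrow> bool" where
  "cospectral_wrt X G H \<longleftrightarrow> spectrum X G = spectrum X H"

text \<open>
  Meant for regular graphs of the same degree, for which cospectrality with respect to one of the
  four matrices implies cospectrality with respect to all of them.
\<close>

definition cospectral :: "'a pair_pre_digraph \<Rightarrow> 'b pair_pre_digraph \<Rightarrow> bool" where
  "cospectral G H \<longleftrightarrow> (\<exists>X. cospectral_wrt X G H)"

definition NICS ::
    "matrix_kind set \<Rightarrow> 'a pair_pre_digraph \<Rightarrow> 'b pair_pre_digraph \<Rightarrow> bool" where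
  "NICS S G H \<longleftrightarrow>
     \<not> digraph_iso (with_proj G) (with_proj H) \<and> (\<forall>X \<in> S. cospectral_wrt X G H)"

definition graph_join ::
    "'a pair_pre_digraph \<Rightarrow> 'b pair_pre_digraph \<Rightarrow> ('a + 'b) pair_pre_digraph" where
  "graph_join G H = \<lparr> pverts = pverts G <+> pverts H,
     parcs = {(Inl u, Inl v) | u v. (u, v) \<in> parcs G}
           \<union> {(Inr u, Inr v) | u v. (u, v) \<in> parcs H}
           \<union> {(Inl u, Inr v) | u v. u \<in> pverts G \<and> v \<in> pverts H}
           \<union> {(Inr v, Inl u) | u v. u \<in> pverts G \<and> v \<in> pverts H} \<rparr>"

text \<open>\<open>Inl w\<close> is a vertex \<open>w\<close> of the join, and \<open>Inr u\<close> is the new vertex \<open>u'\<close> for \<open>u\<close> in \<open>G\<close>.\<close>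

definition ns_join ::
    "'a pair_pre_digraph \<Rightarrow> 'b pair_pre_digraph \<Rightarrow> (('a + 'b) + 'a) pair_pre_digraph" where
  "ns_join G H = \<lparr> pverts = pverts (graph_join G H) <+> pverts G,
     parcs = {(Inl x, Inl y) | x y. (x, y) \<in> parcs (graph_join G H)}
           \<union> {(Inr u, Inl (Inl v)) | u v. (u, v) \<in> parcs G}
           \<union> {(Inl (Inl v), Inr u) | u v. (u, v) \<in> parcs G} \<rparr>"

lemma pair_graph_iff:
  "pair_graph G \<longleftrightarrow> finite (pverts G) \<and> parcs G \<subseteq> pverts G \<times> pverts G \<and> sym (parcs G) \<and> irrefl (parcs G)"
proof
  assume "pair_graph G"
  then interpret pair_graph G .
  show "finite (pverts G) \<and> parcs G \<subseteq> pverts G \<times> pverts G \<and> sym (parcs G) \<and> irrefl (parcs G)"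
    using pair_finite_verts in_arcsD1 in_arcsD2 pair_sym_arcs no_loops'
    unfolding symmetric_def irrefl_def by (metis SigmaI subrelI with_proj_simps(3))
next
  assume *: "finite (pverts G) \<and> parcs G \<subseteq> pverts G \<times> pverts G \<and> sym (parcs G) \<and> irrefl (parcs G)"
  then have "finite (parcs G)" by (meson finite_SigmaI finite_subset)
  with * show "pair_graph G"
    by unfold_locales (auto simp: symmetric_def irrefl_def)
qed

lemma pair_graph_graph_join: "pair_graph G \<Longrightarrow> pair_graph H \<Longrightarrow> pair_graph (graph_join G H)"
  unfolding pair_graph_iff graph_join_def sym_def irrefl_def by auto

lemma pair_graph_ns_join:
  assumes "pair_graph G" "pair_graph H"
  shows "pair_graph (ns_join G H)"
  using assms pair_graph_graph_join[OF assms]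
  unfolding pair_graph_iff ns_join_def sym_def irrefl_def by (auto simp: graph_join_def)

lemma eigenvalue_mset_mat_permute:
  fixes M :: "real mat"
  assumes M: "M \<in> carrier_mat n n" and p: "p permutes {..<n}"
  shows "eigenvalue_mset (mat n n (\<lambda>(i, j). M $$ (p i, p j))) = eigenvalue_mset M"
proof -
  define N where "N = map_mat complex_of_real M"
  have N: "N \<in> carrier_mat n n" using M by (simp add: N_def)
  define P where "P = mat n n (\<lambda>(i, j). if j = p i then 1 else (0::complex))"
  define R where "R = mat n n (\<lambda>(i, j). if i = p j then 1 else (0::complex))"
  have car: "P \<in> carrier_mat n n" "R \<in> carrier_mat n n" by (auto simp: P_def R_def)
  have pl: "p i < n" if "i < n" for i using permutes_in_image[OF p, of i] that by simp
  have pe: "p i = p j \<longleftrightarrow> i = j" for i j using permutes_inj[OF p] by (auto dest: injD)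
  have PR: "P * R = 1\<^sub>m n"
  proof (rule eq_matI)
    fix i j assume "i < dim_row (1\<^sub>m n :: complex mat)" "j < dim_col (1\<^sub>m n :: complex mat)"
    then have ij: "i < n" "j < n" by auto
    then have "(P * R) $$ (i, j) = (\<Sum>k = 0..<n. P $$ (i, k) * R $$ (k, j))"
      using car by (simp add: scalar_prod_def)
    also have "\<dots> = (\<Sum>k = 0..<n. if k = p i then (if k = p j then 1 else 0) else 0)"
      using ij by (intro sum.cong) (auto simp: P_def R_def)
    finally show "(P * R) $$ (i, j) = 1\<^sub>m n $$ (i, j)" using ij by (simp add: pl pe)
  qed (auto simp: P_def R_def)
  have RP: "R * P = 1\<^sub>m n" using car PR by (metis mat_mult_left_right_inverse)
  have "similar_mat (mat n n (\<lambda>(i, j). N $$ (p i, p j))) N"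
  proof (rule similar_matI[of _ _ P R n])
    have PN: "P * N = mat n n (\<lambda>(i, j). N $$ (p i, j))"
      using N by (intro eq_matI) (auto simp: P_def scalar_prod_def if_distrib if_distribR pl cong: if_cong)
    show "mat n n (\<lambda>(i, j). N $$ (p i, p j)) = P * N * R"
      unfolding PN by (intro eq_matI) (auto simp: R_def scalar_prod_def if_distrib pl cong: if_cong)
  qed (use PR RP car N in auto)
  from char_poly_similar[OF this] show ?thesis
  proof -
    have "map_mat complex_of_real (mat n n (\<lambda>(i, j). M $$ (p i, p j))) = mat n n (\<lambda>(i, j). N $$ (p i, p j))"
      using M by (intro eq_matI) (auto simp: N_def pl)
    then show ?thesis
      using \<open>char_poly (mat n n (\<lambda>(i, j). N $$ (p i, p j))) = char_poly N\<close>
      by (simp add: eigenvalue_mset_def N_def)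
  qed
qed

text \<open>The choice of the enumeration in \<^const>\<open>spectrum\<close> is immaterial.\<close>

lemma spectrum_eq:
  assumes vs: "distinct vs" "set vs = pverts G"
  shows "spectrum X G = eigenvalue_mset (graph_matrix X G vs)"
proof -
  define ws where "ws = (SOME vs. distinct vs \<and> set vs = pverts G)"
  have ws: "distinct ws \<and> set ws = pverts G"
    unfolding ws_def by (rule someI[of _ vs]) (use vs in simp)
  define n where "n = length vs"
  have "mset ws = mset vs" using ws vs by (metis set_eq_iff_mset_eq_distinct)
  then obtain p where p: "p permutes {..<length vs}" "permute_list p vs = ws"
    by (rule mset_eq_permutation)
  have len: "length ws = n" using p by (auto simp: n_def)
  have nth: "ws ! i = vs ! p i" if "i < n" for i
    using p that by (auto simp: n_def permute_list_nth)
  have pl: "p i < n" if "i < n" for i using permutes_in_image[OF p(1), of i] that by (simp add: n_def)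
  have pe: "p i = p j \<longleftrightarrow> i = j" for i j using permutes_inj[OF p(1)] by (auto dest: injD)
  have diag: "S * A * S = mat n n (\<lambda>(i, j). f (us ! i) * A $$ (i, j) * f (us ! j))"
    if "S = mat n n (\<lambda>(i, j). if i = j then f (us ! i) else 0)" "A \<in> carrier_mat n n"
    for S A and f :: "'a \<Rightarrow> real" and us
  proof -
    have SA: "S * A = mat n n (\<lambda>(i, j). f (us ! i) * A $$ (i, j))"
      using that by (intro eq_matI) (auto simp: scalar_prod_def if_distrib if_distribR cong: if_cong)
    show ?thesis unfolding SA unfolding that(1)
      by (intro eq_matI) (auto simp: scalar_prod_def if_distrib cong: if_cong)
  qed
  have M: "graph_matrix X G vs \<in> carrier_mat n n"
    by (cases X) (auto simp: adj_matrix_def degree_diag_def n_def Let_def)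
  have "graph_matrix X G ws = mat n n (\<lambda>(i, j). graph_matrix X G vs $$ (p i, p j))"
  proof (cases X)
    case Normalized_Laplacian
    let ?s = "\<lambda>v. if out_degree (with_proj G) v = 0 then 0 else 1 / sqrt (real (out_degree (with_proj G) v))"
    have "degree_diag (\<lambda>d. if d = 0 then 0 else 1 / sqrt (real d)) G us
        = mat n n (\<lambda>(i, j). if i = j then ?s (us ! i) else 0)"
      "adj_matrix G us \<in> carrier_mat n n" if "length us = n" for us
      using that by (simp_all add: degree_diag_def adj_matrix_def)
    note d = diag[OF this]
    show ?thesis
      unfolding Normalized_Laplacian graph_matrix.simps Let_def d[OF len, OF len] d[OF n_def[symmetric], OF n_def[symmetric]]
      by (intro eq_matI)
        (auto simp: adj_matrix_def degree_diag_def len n_def[symmetric] nth pl pe)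
  qed (auto intro!: eq_matI simp: adj_matrix_def degree_diag_def len n_def[symmetric] nth pl pe)
  then show ?thesis
    using eigenvalue_mset_mat_permute[OF M, of p] p(1) by (simp add: spectrum_def ws_def n_def)
qed

end

theory Submission
  imports Defs
begin

text \<open>
  Each of the four matrices of the NS join of regular graphs is a block matrix in \<open>A(G1)\<close>, \<open>A(G2)\<close>,
  identity and all-ones blocks whose coefficients depend only on orders and degrees. For all but
  finitely many \<open>t\<close>, the all-ones vectors being eigenvectors reduces \<open>det (t I - M)\<close> to a determinant
  in \<open>A(G2)\<close>, a factor that depends only on orders and degrees, and \<open>det (q(A(G1)))\<close> with \<open>q\<close> of
  degree at most two; factoring \<open>q\<close> over the complex numbers expresses the latter by the
  characteristic polynomial of \<open>A(G1)\<close>.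

  For non-isomorphism, the new vertices are recognised by their degree \<open>r1\<close>. If \<open>r1 > 0\<close>, the
  vertices of \<open>G2\<close> are the old vertices without new neighbours. If \<open>r1 = 0\<close>, an isomorphism that
  does not respect \<open>G2\<close> is corrected by exchanging two independent sets of equal size.
\<close>

section \<open>Determinants of quadratic matrix polynomials\<close>

lemma poly_char_poly:
  fixes A :: "'a :: field mat"
  assumes "A \<in> carrier_mat n n"
  shows "poly (char_poly A) t = det (t \<cdot>\<^sub>m 1\<^sub>m n - A)"
  unfolding char_poly_matrix[OF assms]
  by (rule arg_cong[where f = det], rule eq_matI) (use assms in \<open>auto simp: char_matrix_def\<close>)

text \<open>Pulling out the scalar \<open>- k1\<close> leaves a characteristic matrix at the point
  \<open>- k0 / k1\<close>.\<close>

lemma det_linear: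
  fixes A :: "'a :: field mat"
  assumes A: "A \<in> carrier_mat n n" and k: "k1 \<noteq> 0"
  shows "det (k0 \<cdot>\<^sub>m 1\<^sub>m n + k1 \<cdot>\<^sub>m A) = (- k1) ^ n * poly (char_poly A) (- k0 / k1)"
proof -
  have "k0 \<cdot>\<^sub>m 1\<^sub>m n + k1 \<cdot>\<^sub>m A = (- k1) \<cdot>\<^sub>m ((- k0 / k1) \<cdot>\<^sub>m 1\<^sub>m n - A)"
    by (rule eq_matI) (use A k in \<open>auto simp: field_simps\<close>)
  then show ?thesis
    using A by (simp add: poly_char_poly[OF A])
qed

text \<open>Eliminating the new vertices from the block matrix of the NS join leaves a matrix of
  this form, up to a multiple of the all-ones matrix. There \<open>k2\<close> becomes
  \<open>- d\<^sup>2\<close>, which is zero for the normalized Laplacian when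
  \<open>r1 = 0\<close>.\<close>

definition quad_mat :: "'a :: comm_ring_1 \<Rightarrow> 'a \<Rightarrow> 'a \<Rightarrow> 'a mat \<Rightarrow> 'a mat" where
  "quad_mat k0 k1 k2 A = k0 \<cdot>\<^sub>m 1\<^sub>m (dim_row A) + k1 \<cdot>\<^sub>m A + k2 \<cdot>\<^sub>m (A * A)"

lemma quad_mat_carrier [simp]: "A \<in> carrier_mat n n \<Longrightarrow> quad_mat k0 k1 k2 A \<in> carrier_mat n n"
  by (simp add: quad_mat_def)

text \<open>The coefficient \<open>1\<close> on \<open>A\<close> stays explicit so that
  \<open>det_linear\<close> matches each factor as it stands.\<close>

lemma quad_mat_factor:
  fixes A :: "'a :: comm_ring_1 mat"
  assumes A: "A \<in> carrier_mat n n"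
  shows "quad_mat (k * s * t) (k * (s + t)) k A
    = k \<cdot>\<^sub>m ((s \<cdot>\<^sub>m 1\<^sub>m n + 1 \<cdot>\<^sub>m A) * (t \<cdot>\<^sub>m 1\<^sub>m n + 1 \<cdot>\<^sub>m A))"
proof -
  have AA: "A * A \<in> carrier_mat n n" using A by simp
  have one: "1 \<cdot>\<^sub>m A = A" by (rule eq_matI) auto
  have "(s \<cdot>\<^sub>m 1\<^sub>m n + 1 \<cdot>\<^sub>m A) * (t \<cdot>\<^sub>m 1\<^sub>m n + 1 \<cdot>\<^sub>m A)
      = (s \<cdot>\<^sub>m 1\<^sub>m n) * (t \<cdot>\<^sub>m 1\<^sub>m n + A) + A * (t \<cdot>\<^sub>m 1\<^sub>m n + A)"
    unfolding one by (rule add_mult_distrib_mat[of _ n n _ _ n]) (use A in auto)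
  also have "\<dots> = (s \<cdot>\<^sub>m 1\<^sub>m n) * (t \<cdot>\<^sub>m 1\<^sub>m n) + (s \<cdot>\<^sub>m 1\<^sub>m n) * A + (A * (t \<cdot>\<^sub>m 1\<^sub>m n) + A * A)"
    using A by (simp add: mult_add_distrib_mat[of _ n n _ n])
  also have "\<dots> = t \<cdot>\<^sub>m (s \<cdot>\<^sub>m 1\<^sub>m n) + s \<cdot>\<^sub>m A + (t \<cdot>\<^sub>m A + A * A)"
    using A by (simp add: mult_smult_distrib[of _ n n _ n] mult_smult_assoc_mat[of _ n n _ n])
  finally show ?thesis
    unfolding quad_mat_def
    by (intro eq_matI) (use A AA in \<open>auto simp: algebra_simps simp del: index_mult_mat(1)\<close>)
qed

text \<open>Quadratic formula: \<open>- s\<close> and \<open>- t\<close> are the roots of the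
  polynomial with coefficients \<open>k0\<close>, \<open>k1\<close>, \<open>k2\<close>; over the
  complex numbers the discriminant always has a square root.\<close>

lemma quadratic_factor_complex:
  fixes k0 k1 k2 :: complex
  assumes "k2 \<noteq> 0"
  obtains s t where "k0 = k2 * s * t" "k1 = k2 * (s + t)"
proof -
  define w where "w = csqrt (k1\<^sup>2 - 4 * k2 * k0)"
  have w: "w * w = k1\<^sup>2 - 4 * k2 * k0" unfolding w_def by (metis power2_csqrt power2_eq_square)
  have "k0 = k2 * ((k1 + w) / (2 * k2)) * ((k1 - w) / (2 * k2))"
  proof -
    have "(k1 + w) * (k1 - w) = 4 * k2 * k0" using w by (simp add: algebra_simps power2_eq_square)
    then have "k2 * ((k1 + w) / (2 * k2)) * ((k1 - w) / (2 * k2)) = k2 * (4 * k2 * k0) / (2 * k2 * (2 * k2))"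
      by simp
    then show ?thesis using assms by simp
  qed
  moreover have "k1 = k2 * ((k1 + w) / (2 * k2) + (k1 - w) / (2 * k2))"
    using assms by (simp add: field_simps)
  ultimately show thesis by (rule that)
qed

text \<open>By multiplicativity the determinant is \<open>k2 ^ n\<close> times the values of the
  characteristic polynomial at \<open>- s\<close> and \<open>- t\<close>. If \<open>k2 = 0\<close>,
  one value suffices; if also \<open>k1 = 0\<close>, the matrix is scalar.\<close>

lemma det_quad_mat_cong:
  fixes A B :: "complex mat"
  assumes A: "A \<in> carrier_mat n n" and B: "B \<in> carrier_mat n n"
    and eq: "char_poly A = char_poly B"
  shows "det (quad_mat k0 k1 k2 A) = det (quad_mat k0 k1 k2 B)"
proof (cases "k2 = 0")
  case True
  have l: "quad_mat k0 k1 k2 C = k0 \<cdot>\<^sub>m 1\<^sub>m n + k1 \<cdot>\<^sub>m C" if "C \<in> carrier_mat n n" for C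
    unfolding quad_mat_def True by (intro eq_matI) (use that in auto)
  show ?thesis
  proof (cases "k1 = 0")
    case True
    have "0 \<cdot>\<^sub>m A = 0 \<cdot>\<^sub>m B" by (intro eq_matI) (use A B in auto)
    then show ?thesis using l[OF A] l[OF B] True by simp
  next
    case False
    then show ?thesis by (simp add: l A B det_linear eq)
  qed
next
  case False
  then obtain s t where st: "k0 = k2 * s * t" "k1 = k2 * (s + t)"
    by (rule quadratic_factor_complex)
  have "det (quad_mat k0 k1 k2 C) = k2 ^ n * (((- 1) ^ n * poly (char_poly C) (- s))
      * ((- 1) ^ n * poly (char_poly C) (- t)))" if C: "C \<in> carrier_mat n n" for C
  proof -
    have c: "x \<cdot>\<^sub>m 1\<^sub>m n + 1 \<cdot>\<^sub>m C \<in> carrier_mat n n" for x using C by simp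
    show ?thesis
      using det_linear[OF C one_neq_zero, of s] det_linear[OF C one_neq_zero, of t] C
      unfolding st quad_mat_factor[OF C] det_smult det_mult[OF c c] by simp
  qed
  then show ?thesis using A B eq by simp
qed

section \<open>Perturbation by multiples of the all-ones matrix\<close>

definition ones_mat :: "nat \<Rightarrow> nat \<Rightarrow> 'a :: one mat" where
  "ones_mat n m = mat n m (\<lambda>_. 1)"

lemma ones_mat_carrier [simp]: "ones_mat n m \<in> carrier_mat n m"
  by (simp add: ones_mat_def)

lemma ones_mat_index [simp]:
  "i < n \<Longrightarrow> j < m \<Longrightarrow> ones_mat n m $$ (i, j) = 1"
  "dim_row (ones_mat n m) = n" "dim_col (ones_mat n m) = m"
  by (simp_all add: ones_mat_def)

text \<open>Each column of \<open>ones_mat n n\<close> is an eigenvector of \<open>A\<close> for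
  \<open>r\<close>, so a polynomial in \<open>A\<close> acts on it by its value at
  \<open>r\<close>.\<close>

lemma quad_mat_ones:
  fixes A :: "'a :: comm_ring_1 mat"
  assumes A: "A \<in> carrier_mat n n" and r: "A * ones_mat n n = r \<cdot>\<^sub>m ones_mat n n"
  shows "quad_mat k0 k1 k2 A * ones_mat n n = (k0 + k1 * r + k2 * r\<^sup>2) \<cdot>\<^sub>m ones_mat n n"
proof -
  have "A * A * ones_mat n n = r \<cdot>\<^sub>m (r \<cdot>\<^sub>m ones_mat n n)"
    using A by (simp add: assoc_mult_mat[of _ n n _ n _ n] r mult_smult_distrib[of _ n n _ n])
  moreover have "quad_mat k0 k1 k2 A * ones_mat n n
      = k0 \<cdot>\<^sub>m ones_mat n n + k1 \<cdot>\<^sub>m (A * ones_mat n n) + k2 \<cdot>\<^sub>m (A * A * ones_mat n n)"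
    unfolding quad_mat_def using A
    by (simp add: add_mult_distrib_mat[of _ n n _ _ n] mult_smult_assoc_mat[of _ n n _ n])
  ultimately show ?thesis
    unfolding r by (intro eq_matI) (auto simp: algebra_simps power2_eq_square)
qed

text \<open>The eigenvalue from \<open>quad_mat_ones\<close> is nonzero, so
  \<open>quad_mat k0 k1 k2 A\<close> can be split off as a left factor. The remaining factor knows
  \<open>A\<close> only through its order and row sum, and its determinant never has to be
  evaluated.\<close>

lemma det_quad_mat_minus_ones:
  fixes A :: "'a :: field mat"
  assumes A: "A \<in> carrier_mat n n" and r: "A * ones_mat n n = r \<cdot>\<^sub>m ones_mat n n"
    and q: "k0 + k1 * r + k2 * r\<^sup>2 \<noteq> 0"
  shows "det (quad_mat k0 k1 k2 A - \<gamma> \<cdot>\<^sub>m ones_mat n n)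
    = det (quad_mat k0 k1 k2 A) * det (1\<^sub>m n - (\<gamma> / (k0 + k1 * r + k2 * r\<^sup>2)) \<cdot>\<^sub>m ones_mat n n)"
proof -
  let ?Q = "quad_mat k0 k1 k2 A" and ?q = "k0 + k1 * r + k2 * r\<^sup>2"
  have Q: "?Q \<in> carrier_mat n n" using A by simp
  have "?Q * (1\<^sub>m n - (\<gamma> / ?q) \<cdot>\<^sub>m ones_mat n n) = ?Q - (\<gamma> / ?q) \<cdot>\<^sub>m (?Q * ones_mat n n)"
    using Q by (simp add: mult_minus_distrib_mat[of _ n n _ n] mult_smult_distrib[of _ n n _ n])
  also have "\<dots> = ?Q - \<gamma> \<cdot>\<^sub>m ones_mat n n"
    unfolding quad_mat_ones[OF A r] by (intro eq_matI) (use Q q in auto)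
  finally show ?thesis
    using det_mult[OF Q, of "1\<^sub>m n - (\<gamma> / ?q) \<cdot>\<^sub>m ones_mat n n"] by (simp add: minus_carrier_mat)
qed

section \<open>Block matrices of NS joins\<close>

text \<open>
  The matrices of the NS join of \<open>G\<close> and \<open>H\<close>, with the vertices ordered as
  \<open>u\<^sub>1, \<dots>, u\<^sub>n, u\<^sub>1', \<dots>, u\<^sub>n', v\<^sub>1, \<dots>, v\<^sub>m\<close>; \<open>A\<close> and \<open>C\<close> stand for the
  adjacency matrices of \<open>G\<close> and \<open>H\<close>.
\<close>

definition ns_block ::
    "'a \<Rightarrow> 'a \<Rightarrow> 'a \<Rightarrow> 'a \<Rightarrow> 'a \<Rightarrow> 'a \<Rightarrow> 'a \<Rightarrow> 'a mat \<Rightarrow> 'a mat \<Rightarrow> 'a :: comm_ring_1 mat" where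
  "ns_block b a d g c f e A C =
    (let n = dim_row A; m = dim_row C in
     four_block_mat
       (four_block_mat (b \<cdot>\<^sub>m 1\<^sub>m n + a \<cdot>\<^sub>m A) (d \<cdot>\<^sub>m A) (d \<cdot>\<^sub>m A) (g \<cdot>\<^sub>m 1\<^sub>m n))
       (mat (n + n) m (\<lambda>(i, j). if i < n then c else 0))
       (mat m (n + n) (\<lambda>(i, j). if j < n then c else 0))
       (f \<cdot>\<^sub>m 1\<^sub>m m + e \<cdot>\<^sub>m C))"

lemma ns_block_carrier:
  "A \<in> carrier_mat n n \<Longrightarrow> C \<in> carrier_mat m m \<Longrightarrow>
    ns_block b a d g c f e A C \<in> carrier_mat (n + n + m) (n + n + m)"
  unfolding ns_block_def Let_def by auto

text \<open>The family \<open>ns_block\<close> is closed under passing to the characteristic matrix,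
  so a determinant formula for arbitrary coefficients yields the characteristic polynomial.\<close>

lemma char_ns_block:
  assumes "A \<in> carrier_mat n n" "C \<in> carrier_mat m m"
  shows "t \<cdot>\<^sub>m 1\<^sub>m (n + n + m) - ns_block b a d g c f e A C
    = ns_block (t - b) (- a) (- d) (t - g) (- c) (t - f) (- e) A C"
  by (rule eq_matI) (use assms in \<open>auto simp: ns_block_def Let_def\<close>)

text \<open>
  Since the all-ones vector is an eigenvector of \<open>f I + e C\<close>, a column operation clears the
  lower-left block; only the all-ones part of the upper-left block changes.
\<close>

lemma det_ns_block:
  fixes A C :: "'a :: field mat"
  assumes A: "A \<in> carrier_mat n n" and C: "C \<in> carrier_mat m m"
    and rowC: "\<And>i. i < m \<Longrightarrow> (\<Sum>j<m. C $$ (i, j)) = r"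
    and \<rho>: "f + e * r \<noteq> 0"
  shows "det (ns_block b a d g c f e A C)
    = det (quad_mat (g * b) (g * a) (- d\<^sup>2) A - (g * (c\<^sup>2 * of_nat m / (f + e * r))) \<cdot>\<^sub>m ones_mat n n)
      * det (f \<cdot>\<^sub>m 1\<^sub>m m + e \<cdot>\<^sub>m C)"
proof -
  let ?\<rho> = "f + e * r"
  define N where "N = four_block_mat (b \<cdot>\<^sub>m 1\<^sub>m n + a \<cdot>\<^sub>m A) (d \<cdot>\<^sub>m A) (d \<cdot>\<^sub>m A) (g \<cdot>\<^sub>m 1\<^sub>m n)"
  define U where "U = mat (n + n) m (\<lambda>(i, j). if i < n then c else 0)"
  define V where "V = mat m (n + n) (\<lambda>(i, j). if j < n then c else 0)"
  define D where "D = f \<cdot>\<^sub>m 1\<^sub>m m + e \<cdot>\<^sub>m C"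
  \<comment> \<open>All rows of \<open>D\<close> sum to \<open>f + e * r\<close>, so this choice
    gives \<open>D * W = - V\<close>. Like \<open>V\<close>, it is zero in the columns of the new
    vertices.\<close>
  define W where "W = mat m (n + n) (\<lambda>(i, j). if j < n then - c / ?\<rho> else 0)"
  have [simp]: "N \<in> carrier_mat (n + n) (n + n)" "U \<in> carrier_mat (n + n) m"
    "V \<in> carrier_mat m (n + n)" "D \<in> carrier_mat m m" "W \<in> carrier_mat m (n + n)"
    using A C by (auto simp: N_def U_def V_def D_def W_def)
  \<comment> \<open>In the block of \<open>G\<close> every entry of \<open>U * W\<close> is a sum of
    \<open>m\<close> equal terms, with value \<open>- \<beta>\<close>; elsewhere
    \<open>U * W\<close> is zero.\<close>
  define \<beta> where "\<beta> = c\<^sup>2 * of_nat m / ?\<rho>"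
  define N' where
    "N' = four_block_mat (b \<cdot>\<^sub>m 1\<^sub>m n + a \<cdot>\<^sub>m A - \<beta> \<cdot>\<^sub>m ones_mat n n) (d \<cdot>\<^sub>m A) (d \<cdot>\<^sub>m A) (g \<cdot>\<^sub>m 1\<^sub>m n)"
  define P where "P = four_block_mat (1\<^sub>m (n + n)) (0\<^sub>m (n + n) m) W (1\<^sub>m m)"
  have M: "ns_block b a d g c f e A C = four_block_mat N U V D"
    using A C by (simp add: ns_block_def N_def U_def V_def D_def)
  have UW: "N + U * W = N'"
    unfolding N_def N'_def
    by (rule eq_matI)
      (use A in \<open>auto simp: U_def W_def scalar_prod_def \<beta>_def power2_eq_square field_simps ones_mat_def\<close>)
  have DW: "V + D * W = 0\<^sub>m m (n + n)"
  proof (rule eq_matI)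
    fix i j assume "i < dim_row (0\<^sub>m m (n + n) :: 'a mat)" "j < dim_col (0\<^sub>m m (n + n) :: 'a mat)"
    then have ij: "i < m" "j < n + n" by auto
    have "(D * W) $$ (i, j) = (\<Sum>k<m. D $$ (i, k)) * (if j < n then - c / ?\<rho> else 0)"
      using ij C
      by (auto simp: W_def D_def scalar_prod_def sum_distrib_right atLeast0LessThan intro!: sum.cong)
    also have "(\<Sum>k<m. D $$ (i, k)) = (\<Sum>k<m. (if k = i then f else 0) + e * C $$ (i, k))"
      using ij C by (intro sum.cong) (auto simp: D_def)
    also have "\<dots> = ?\<rho>"
      using ij rowC by (simp add: sum.distrib flip: sum_distrib_left)
    finally have "(D * W) $$ (i, j) = - (if j < n then c else 0)" using \<rho> by simp
    moreover have "dim_row (D * W) = m" "dim_col (D * W) = n + n" by (use C in \<open>simp_all add: D_def W_def\<close>)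
    ultimately show "(V + D * W) $$ (i, j) = 0\<^sub>m m (n + n) $$ (i, j)"
      using ij by (simp add: V_def del: index_mult_mat)
  qed (simp_all add: D_def W_def C[THEN carrier_matD(1)])
  have "four_block_mat N U V D * P = four_block_mat N' U (0\<^sub>m m (n + n)) D"
    unfolding P_def
    by (subst mult_four_block_mat[of _ "n + n" "n + n" _ m _ m _ _ "n + n" _ m]) 
      (auto simp: UW DW right_mult_one_mat[of N "n + n" "n + n"] right_mult_one_mat[of U "n + n" m]
        right_mult_one_mat[of V m "n + n"] right_mult_one_mat[of D m m]
        right_mult_zero_mat[of N "n + n" "n + n"] right_mult_zero_mat[of V m "n + n"]
        left_add_zero_mat[of U "n + n" m] left_add_zero_mat[of D m m])
  moreover have "det P = 1"
    unfolding P_def by (subst det_four_block_mat_upper_right_zero[of _ "n + n" _ m]) auto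
  moreover have "P \<in> carrier_mat (n + n + m) (n + n + m)" by (simp add: P_def)
  moreover have "N' \<in> carrier_mat (n + n) (n + n)" using A by (simp add: N'_def minus_carrier_mat)
  ultimately have "det (ns_block b a d g c f e A C) = det N' * det D"
    using det_mult[of "four_block_mat N U V D" "n + n + m" P]
    by (simp add: M det_four_block_mat_lower_left_zero[of _ "n + n" _ m])
  moreover have "det N' = det (quad_mat (g * b) (g * a) (- d\<^sup>2) A - (g * \<beta>) \<cdot>\<^sub>m ones_mat n n)"
  proof -
    let ?B = "b \<cdot>\<^sub>m 1\<^sub>m n + a \<cdot>\<^sub>m A - \<beta> \<cdot>\<^sub>m ones_mat n n"
    have B: "?B \<in> carrier_mat n n" using A by (simp add: minus_carrier_mat)
    have AA: "A * A \<in> carrier_mat n n" using A by simp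
    \<comment> \<open>A scalar block commutes with \<open>d \<cdot>\<^sub>m A\<close>, so the Schur
      formula applies without inverting \<open>g\<close>.\<close>
    have comm: "d \<cdot>\<^sub>m A * (g \<cdot>\<^sub>m 1\<^sub>m n) = g \<cdot>\<^sub>m 1\<^sub>m n * (d \<cdot>\<^sub>m A)"
      using A by (auto simp: mult_smult_distrib[of _ n n _ n] mult_smult_assoc_mat[of _ n n _ n]
          intro!: eq_matI)
    have "det N' = det (?B * (g \<cdot>\<^sub>m 1\<^sub>m n) - d \<cdot>\<^sub>m A * (d \<cdot>\<^sub>m A))"
      unfolding N'_def by (rule det_four_block_mat[OF B _ _ _ comm]) (use A in auto)
    also have "?B * (g \<cdot>\<^sub>m 1\<^sub>m n) - d \<cdot>\<^sub>m A * (d \<cdot>\<^sub>m A) = g \<cdot>\<^sub>m ?B - d \<cdot>\<^sub>m (d \<cdot>\<^sub>m (A * A))"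
      using A B by (simp add: mult_smult_distrib[of _ n n _ n] mult_smult_assoc_mat[of _ n n _ n])
    also have "\<dots> = quad_mat (g * b) (g * a) (- d\<^sup>2) A - (g * \<beta>) \<cdot>\<^sub>m ones_mat n n"
      unfolding quad_mat_def
      by (rule eq_matI) (use A AA in \<open>auto simp: algebra_simps power2_eq_square simp del: index_mult_mat(1)\<close>)
    finally show ?thesis .
  qed
  ultimately show ?thesis by (simp add: \<beta>_def D_def)
qed

lemma mult_ones_mat:
  fixes A :: "'a :: comm_ring_1 mat"
  assumes "A \<in> carrier_mat n n" "\<And>i. i < n \<Longrightarrow> (\<Sum>j<n. A $$ (i, j)) = r"
  shows "A * ones_mat n n = r \<cdot>\<^sub>m ones_mat n n"
  by (rule eq_matI)
    (use assms in \<open>auto simp: scalar_prod_def ones_mat_def atLeast0LessThan intro!: sum.cong\<close>)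

text \<open>The three factors separate the data: the first involves \<open>A\<close>, the last
  involves \<open>C\<close>, and the middle one only orders, row sums and coefficients.\<close>

lemma det_ns_block_regular:
  fixes A C :: "'a :: field mat"
  assumes A: "A \<in> carrier_mat n n" and C: "C \<in> carrier_mat m m"
    and rowA: "\<And>i. i < n \<Longrightarrow> (\<Sum>j<n. A $$ (i, j)) = r1"
    and rowC: "\<And>i. i < m \<Longrightarrow> (\<Sum>j<m. C $$ (i, j)) = r2"
    and \<rho>: "f + e * r2 \<noteq> 0"
    and q: "g * b + g * a * r1 + - d\<^sup>2 * r1\<^sup>2 \<noteq> 0"
  shows "det (ns_block b a d g c f e A C)
    = det (quad_mat (g * b) (g * a) (- d\<^sup>2) A)
      * det (1\<^sub>m n - (g * (c\<^sup>2 * of_nat m / (f + e * r2)) / (g * b + g * a * r1 + - d\<^sup>2 * r1\<^sup>2))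
          \<cdot>\<^sub>m ones_mat n n)
      * det (f \<cdot>\<^sub>m 1\<^sub>m m + e \<cdot>\<^sub>m C)"
  by (simp only: det_ns_block[OF A C rowC \<rho>] det_quad_mat_minus_ones[OF A mult_ones_mat[OF A rowA] q])

text \<open>\<open>det_ns_block_regular\<close> gives equal values at every \<open>t\<close> at
  which its two denominators are nonzero. This excludes finitely many \<open>t\<close>, and
  polynomials that agree at infinitely many points are equal.\<close>

lemma char_poly_ns_block_cong:
  fixes A A' C C' :: "complex mat"
  assumes A: "A \<in> carrier_mat n n" "A' \<in> carrier_mat n n"
    and C: "C \<in> carrier_mat m m" "C' \<in> carrier_mat m m"
    and rowA: "\<And>i. i < n \<Longrightarrow> (\<Sum>j<n. A $$ (i, j)) = r1" "\<And>i. i < n \<Longrightarrow> (\<Sum>j<n. A' $$ (i, j)) = r1"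
    and rowC: "\<And>i. i < m \<Longrightarrow> (\<Sum>j<m. C $$ (i, j)) = r2" "\<And>i. i < m \<Longrightarrow> (\<Sum>j<m. C' $$ (i, j)) = r2"
    and eqA: "char_poly A = char_poly A'" and eqC: "char_poly C = char_poly C'"
  shows "char_poly (ns_block b a d g c f e A C) = char_poly (ns_block b a d g c f e A' C')"
    (is "?p = ?q")
proof -
  \<comment> \<open>The second denominator as a polynomial in \<open>t\<close>. It is monic, hence
    has finitely many roots whatever the coefficients are.\<close>
  let ?k = "[: g * (b + a * r1) - (d * r1)\<^sup>2, - (g + b + a * r1), 1 :]"
  let ?S = "{t. t - f + - e * r2 = 0} \<union> {t. poly ?k t = 0}"
  have k: "poly ?k t = (t - g) * (t - b) + (t - g) * - a * r1 + - (- d)\<^sup>2 * r1\<^sup>2" for t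
    by (simp add: algebra_simps power2_eq_square)
  have "poly ?p t = poly ?q t" if t: "t \<notin> ?S" for t
  proof -
    have \<rho>: "t - f + - e * r2 \<noteq> 0" using t by auto
    have q: "(t - g) * (t - b) + (t - g) * - a * r1 + - (- d)\<^sup>2 * r1\<^sup>2 \<noteq> 0"
      using t unfolding k by auto
    have lin: "det ((t - f) \<cdot>\<^sub>m 1\<^sub>m m + - e \<cdot>\<^sub>m C) = det ((t - f) \<cdot>\<^sub>m 1\<^sub>m m + - e \<cdot>\<^sub>m C')"
    proof (cases "e = 0")
      case True
      have "- e \<cdot>\<^sub>m C = - e \<cdot>\<^sub>m C'" by (rule eq_matI) (use C True in auto)
      then show ?thesis by simp
    next
      case False
      then show ?thesis using eqC det_linear[OF C(1)] det_linear[OF C(2)] by simp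
    qed
    show ?thesis
      unfolding poly_char_poly[OF ns_block_carrier[OF A(1) C(1)]] char_ns_block[OF A(1) C(1)]
        poly_char_poly[OF ns_block_carrier[OF A(2) C(2)]] char_ns_block[OF A(2) C(2)]
      using det_ns_block_regular[OF A(1) C(1) rowA(1) rowC(1) \<rho> q, of "- c"]
        det_ns_block_regular[OF A(2) C(2) rowA(2) rowC(2) \<rho> q, of "- c"]
        det_quad_mat_cong[OF A eqA] lin by simp
  qed
  then have "UNIV = ?S \<union> {t. poly (?p - ?q) t = 0}" by auto
  moreover have "finite ?S"
  proof -
    have "{t. t - f + - e * r2 = 0} = {f + e * r2}" by (auto simp: algebra_simps eq_diff_eq)
    moreover have "finite {t. poly ?k t = 0}" by (rule poly_roots_finite) simp
    ultimately show ?thesis by simp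
  qed
  ultimately have "infinite {t. poly (?p - ?q) t = 0}"
    using infinite_UNIV_char_0[where 'a = complex] by (metis finite_Un)
  then have "?p - ?q = 0" using poly_roots_finite by blast
  then show ?thesis by simp
qed

text \<open>A characteristic polynomial is monic and splits over the complex numbers, so its roots
  with multiplicities determine it. The orders may differ a priori; their equality is then read off
  from the degrees.\<close>

lemma eigenvalue_mset_eq_iff:
  assumes "M \<in> carrier_mat n n" "N \<in> carrier_mat m m"
  shows "eigenvalue_mset M = eigenvalue_mset N \<longleftrightarrow>
    char_poly (map_mat complex_of_real M) = char_poly (map_mat complex_of_real N)"
proof
  assume eq: "eigenvalue_mset M = eigenvalue_mset N"
  have decomp: "char_poly (map_mat complex_of_real L) = (\<Prod>x\<in>#eigenvalue_mset L. [:- x, 1:])"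
    if "L \<in> carrier_mat k k" for L k
  proof -
    have "lead_coeff (char_poly (map_mat complex_of_real L)) = 1"
      using degree_monic_char_poly[of "map_mat complex_of_real L" k] that by auto
    then show ?thesis
      using complex_poly_decompose_multiset[of "char_poly (map_mat complex_of_real L)"]
      by (simp only: smult_1_left eigenvalue_mset_def)
  qed
  show "char_poly (map_mat complex_of_real M) = char_poly (map_mat complex_of_real N)"
    unfolding decomp[OF assms(1)] decomp[OF assms(2)] eq ..
qed (simp add: eigenvalue_mset_def)

lemma char_poly_eq_imp_dim_eq:
  assumes "A \<in> carrier_mat n n" "B \<in> carrier_mat m m" "char_poly A = char_poly B"
  shows "n = m"
  using degree_monic_char_poly[OF assms(1)] degree_monic_char_poly[OF assms(2)] assms(3) by simp

section \<open>Matrices of regular graphs\<close>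

text \<open>
  All four matrices have diagonal entries \<open>diag_coeff X (deg v)\<close> and, at an edge \<open>uv\<close>, the entry
  \<open>edge_coeff X (deg u) (deg v)\<close>.
\<close>

definition diag_coeff :: "matrix_kind \<Rightarrow> nat \<Rightarrow> real" where
  "diag_coeff X k = (case X of Adjacency \<Rightarrow> 0 | Laplacian \<Rightarrow> real k | Signless_Laplacian \<Rightarrow> real k
    | Normalized_Laplacian \<Rightarrow> if k = 0 then 0 else 1)"

definition edge_coeff :: "matrix_kind \<Rightarrow> nat \<Rightarrow> nat \<Rightarrow> real" where
  "edge_coeff X k l = (case X of Adjacency \<Rightarrow> 1 | Laplacian \<Rightarrow> -1 | Signless_Laplacian \<Rightarrow> 1
    | Normalized_Laplacian \<Rightarrow> if k = 0 \<or> l = 0 then 0 else - 1 / (sqrt (real k) * sqrt (real l)))"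

lemma edge_coeff_commute: "edge_coeff X k l = edge_coeff X l k"
  by (auto simp: edge_coeff_def split: matrix_kind.split)

text \<open>Lets the adjacency matrix of a regular graph of positive degree be recovered from any of
  the four matrices.\<close>

lemma edge_coeff_nonzero: "k \<noteq> 0 \<Longrightarrow> edge_coeff X k k \<noteq> 0"
  by (auto simp: edge_coeff_def split: matrix_kind.split)

abbreviation deg :: "'a pair_pre_digraph \<Rightarrow> 'a \<Rightarrow> nat" where
  "deg G v \<equiv> out_degree (with_proj G) v"

lemma deg_card: "deg G v = card {w. (v, w) \<in> parcs G}"
proof -
  have "out_arcs (with_proj G) v = Pair v ` {w. (v, w) \<in> parcs G}"
    by (auto simp: out_arcs_def)
  then show ?thesis by (simp add: out_degree_def card_image inj_on_def)
qed

lemma diag_mult_diag: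
  fixes A :: "real mat"
  assumes "A \<in> carrier_mat n n"
  shows "mat n n (\<lambda>(i, j). if i = j then f i else 0) * A * mat n n (\<lambda>(i, j). if i = j then f i else 0)
    = mat n n (\<lambda>(i, j). f i * A $$ (i, j) * f j)"
proof -
  have "mat n n (\<lambda>(i, j). if i = j then f i else 0) * A = mat n n (\<lambda>(i, j). f i * A $$ (i, j))"
    using assms by (intro eq_matI) (auto simp: scalar_prod_def if_distrib if_distribR cong: if_cong)
  then show ?thesis
    by (intro eq_matI) (auto simp: scalar_prod_def if_distrib cong: if_cong)
qed

text \<open>The diagonal is tested on vertices instead of indices, so that an entry depends only on
  the two vertices; by distinctness both tests agree.\<close>

lemma graph_matrix_index:
  assumes "distinct vs"
  shows "graph_matrix X G vs = mat (length vs) (length vs) (\<lambda>(i, j).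
    (if vs ! i = vs ! j then diag_coeff X (deg G (vs ! i)) else 0)
    + (if (vs ! i, vs ! j) \<in> parcs G then edge_coeff X (deg G (vs ! i)) (deg G (vs ! j)) else 0))"
proof (cases X)
  case Normalized_Laplacian
  let ?s = "\<lambda>i. if deg G (vs ! i) = 0 then 0 else 1 / sqrt (real (deg G (vs ! i)))"
  have "degree_diag (\<lambda>d. if d = 0 then 0 else 1 / sqrt (real d)) G vs
      = mat (length vs) (length vs) (\<lambda>(i, j). if i = j then ?s i else 0)"
    by (simp add: degree_diag_def)
  then have "graph_matrix X G vs = degree_diag (\<lambda>d. if d = 0 then 0 else 1) G vs
      - mat (length vs) (length vs) (\<lambda>(i, j). ?s i * adj_matrix G vs $$ (i, j) * ?s j)"
    unfolding Normalized_Laplacian graph_matrix.simps Let_def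
    using diag_mult_diag[of "adj_matrix G vs" "length vs" ?s] by (simp add: adj_matrix_def)
  then show ?thesis
    using assms unfolding Normalized_Laplacian
    by (intro eq_matI)
      (auto simp: degree_diag_def adj_matrix_def diag_coeff_def edge_coeff_def nth_eq_iff_index_eq)
qed (use assms in \<open>auto intro!: eq_matI
  simp: degree_diag_def adj_matrix_def diag_coeff_def edge_coeff_def nth_eq_iff_index_eq\<close>)

lemma graph_matrix_regular:
  assumes "distinct vs" "set vs = pverts G" "regular r G"
  shows "graph_matrix X G vs
    = diag_coeff X r \<cdot>\<^sub>m 1\<^sub>m (length vs) + edge_coeff X r r \<cdot>\<^sub>m adj_matrix G vs"
proof -
  have "deg G (vs ! i) = r" if "i < length vs" for i
    using assms nth_mem[OF that] by (auto simp: regular_def)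
  then show ?thesis
    unfolding graph_matrix_index[OF assms(1)]
    by (intro eq_matI) (auto simp: adj_matrix_def nth_eq_iff_index_eq[OF assms(1)])
qed

lemma sum_adj_matrix_row:
  assumes "pair_graph G" "distinct vs" "set vs = pverts G" "i < length vs"
  shows "(\<Sum>j<length vs. adj_matrix G vs $$ (i, j)) = real (deg G (vs ! i))"
proof -
  have sub: "parcs G \<subseteq> pverts G \<times> pverts G" using assms(1) by (simp add: pair_graph_iff)
  have "(\<Sum>j<length vs. adj_matrix G vs $$ (i, j))
      = (\<Sum>j<length vs. (if (vs ! i, vs ! j) \<in> parcs G then 1 else 0))"
    using assms(4) by (intro sum.cong) (auto simp: adj_matrix_def)
  also have "\<dots> = (\<Sum>w\<in>set vs. if (vs ! i, w) \<in> parcs G then 1 else 0)"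
    by (rule sum.reindex_bij_betw) (rule bij_betw_nth[OF assms(2) refl refl])
  also have "\<dots> = (\<Sum>w\<in>{w. (vs ! i, w) \<in> parcs G}. 1)"
    by (rule sum.mono_neutral_cong_right) (use assms(3) sub assms(1)[unfolded pair_graph_iff] in auto)
  finally show ?thesis by (simp add: deg_card)
qed

section \<open>The NS join\<close>

lemma pverts_ns_join: "pverts (ns_join G H) = (Inl \<circ> Inl) ` pverts G \<union> (Inl \<circ> Inr) ` pverts H \<union> Inr ` pverts G"
  by (auto simp: ns_join_def graph_join_def)

lemma arcs_ns_join [simp]:
  "(Inl (Inl u), Inl (Inl v)) \<in> parcs (ns_join G H) \<longleftrightarrow> (u, v) \<in> parcs G"
  "(Inl (Inl u), Inl (Inr y)) \<in> parcs (ns_join G H) \<longleftrightarrow> u \<in> pverts G \<and> y \<in> pverts H"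
  "(Inl (Inr y), Inl (Inl u)) \<in> parcs (ns_join G H) \<longleftrightarrow> u \<in> pverts G \<and> y \<in> pverts H"
  "(Inl (Inr x), Inl (Inr y)) \<in> parcs (ns_join G H) \<longleftrightarrow> (x, y) \<in> parcs H"
  "(Inl (Inl u), Inr v) \<in> parcs (ns_join G H) \<longleftrightarrow> (v, u) \<in> parcs G"
  "(Inr u, Inl (Inl v)) \<in> parcs (ns_join G H) \<longleftrightarrow> (u, v) \<in> parcs G"
  "(Inl (Inr y), Inr v) \<notin> parcs (ns_join G H)"
  "(Inr v, Inl (Inr y)) \<notin> parcs (ns_join G H)"
  "(Inr u, Inr v) \<notin> parcs (ns_join G H)"
  by (auto simp: ns_join_def graph_join_def)

lemma pair_graph_arc_commute: "pair_graph G \<Longrightarrow> (u, v) \<in> parcs G \<longleftrightarrow> (v, u) \<in> parcs G"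
  by (auto simp: pair_graph_iff dest: symD)

lemma pair_graph_finite_nbrs: "pair_graph G \<Longrightarrow> finite {w. (v, w) \<in> parcs G}"
  unfolding pair_graph_iff by (rule finite_subset[of _ "pverts G"]) auto

text \<open>Each neighbour in \<open>G\<close> counts twice, once for itself and once for its new
  copy.\<close>

lemma deg_ns_join_Inl_Inl:
  assumes "pair_graph G" "pair_graph H" "u \<in> pverts G"
  shows "deg (ns_join G H) (Inl (Inl u)) = 2 * deg G u + card (pverts H)"
proof -
  let ?N = "{w. (u, w) \<in> parcs G}"
  have "{x. (Inl (Inl u), x) \<in> parcs (ns_join G H)}
      = (Inl \<circ> Inl) ` ?N \<union> (Inr ` ?N \<union> (Inl \<circ> Inr) ` pverts H)"
    (is "?L = ?A \<union> (?B \<union> ?C)")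
  proof (rule Set.set_eqI)
    fix x
    show "x \<in> ?L \<longleftrightarrow> x \<in> ?A \<union> (?B \<union> ?C)"
      using assms pair_graph_arc_commute[OF assms(1)] by (cases x rule: sum.exhaust; cases "projl x") auto
  qed
  moreover have "card (?A \<union> (?B \<union> ?C)) = card ?A + (card ?B + card ?C)"
    using assms(2) pair_graph_finite_nbrs[OF assms(1)]
    by (subst card_Un_disjoint, auto simp: pair_graph_iff, subst card_Un_disjoint, auto)
  ultimately show ?thesis
    by (simp add: deg_card card_image inj_on_def)
qed

lemma deg_ns_join_Inl_Inr:
  assumes "pair_graph G" "pair_graph H" "y \<in> pverts H"
  shows "deg (ns_join G H) (Inl (Inr y)) = deg H y + card (pverts G)"
proof -
  have "{x. (Inl (Inr y), x) \<in> parcs (ns_join G H)}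
      = (Inl \<circ> Inr) ` {w. (y, w) \<in> parcs H} \<union> (Inl \<circ> Inl) ` pverts G" (is "?L = ?R")
  proof (rule Set.set_eqI)
    fix x
    show "x \<in> ?L \<longleftrightarrow> x \<in> ?R"
      using assms by (cases x rule: sum.exhaust; cases "projl x") auto
  qed
  then show ?thesis
    using assms(1) pair_graph_finite_nbrs[OF assms(2)]
    by (subst deg_card, simp, subst card_Un_disjoint)
      (auto simp: card_image inj_on_def deg_card pair_graph_iff)
qed

lemma deg_ns_join_Inr: "deg (ns_join G H) (Inr u) = deg G u"
proof -
  have "{x. (Inr u, x) \<in> parcs (ns_join G H)} = (Inl \<circ> Inl) ` {w. (u, w) \<in> parcs G}" (is "?L = ?R")
  proof (rule Set.set_eqI)
    fix x
    show "x \<in> ?L \<longleftrightarrow> x \<in> ?R"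
      by (cases x rule: sum.exhaust; cases "projl x") auto
  qed
  then show ?thesis by (simp add: deg_card card_image inj_on_def)
qed

text \<open>Degrees in the join are constant on each of the three classes of vertices:
  \<open>k1\<close> on \<open>G\<close>, \<open>r1\<close> on the new vertices, \<open>k2\<close> on
  \<open>H\<close>. Hence the entry coefficients are constant on each block.\<close>

lemma graph_matrix_ns_join:
  assumes G: "pair_graph G" "regular r1 G" "distinct us" "set us = pverts G"
    and H: "pair_graph H" "regular r2 H" "distinct ws" "set ws = pverts H"
    and vs: "vs = map (Inl \<circ> Inl) us @ map Inr us @ map (Inl \<circ> Inr) ws"
    and k: "k1 = 2 * r1 + length ws" "k2 = r2 + length us"
  shows "graph_matrix X (ns_join G H) vs
    = ns_block (diag_coeff X k1) (edge_coeff X k1 k1) (edge_coeff X k1 r1) (diag_coeff X r1)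
        (edge_coeff X k1 k2) (diag_coeff X k2) (edge_coeff X k2 k2) (adj_matrix G us) (adj_matrix H ws)"
proof -
  let ?n = "length us" and ?m = "length ws" and ?J = "ns_join G H"
  have dist: "distinct vs"
    using G(3) H(3) by (auto simp: vs distinct_map inj_on_def)
  have card: "card (pverts G) = ?n" "card (pverts H) = ?m"
    using G H distinct_card by metis+
  have usG: "us ! i \<in> pverts G" "deg G (us ! i) = r1" if "i < ?n" for i
    using G nth_mem[OF that] by (auto simp: regular_def)
  have wsH: "ws ! i \<in> pverts H" "deg H (ws ! i) = r2" if "i < ?m" for i
    using H nth_mem[OF that] by (auto simp: regular_def)
  have deg: "deg ?J (Inl (Inl (us ! i))) = k1" "deg ?J (Inr (us ! i)) = r1" if "i < ?n" for i
    using usG[OF that] by (simp_all add: deg_ns_join_Inl_Inl[OF G(1) H(1)] deg_ns_join_Inr card k)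
  have deg': "deg ?J (Inl (Inr (ws ! i))) = k2" if "i < ?m" for i
    using wsH[OF that] by (simp add: deg_ns_join_Inl_Inr[OF G(1) H(1)] card k)
  have adj: "adj_matrix G us \<in> carrier_mat ?n ?n" "adj_matrix H ws \<in> carrier_mat ?m ?m"
    by (simp_all add: adj_matrix_def)
  have irr: "(u, u) \<notin> parcs G" "(y, y) \<notin> parcs H" for u y
    using G(1) H(1) by (auto simp: pair_graph_iff irrefl_def)
  \<comment> \<open>Each index lies in one of three segments; for two indices this gives the nine
    blocks, which are compared entry by entry.\<close>
  have part: "(i < ?n \<and> vs ! i = Inl (Inl (us ! i)))
      \<or> (\<exists>i'. i = ?n + i' \<and> i' < ?n \<and> vs ! i = Inr (us ! i'))
      \<or> (\<exists>i'. i = ?n + ?n + i' \<and> i' < ?m \<and> vs ! i = Inl (Inr (ws ! i')))"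
    if "i < ?n + ?n + ?m" for i
  proof -
    consider "i < ?n" | "?n \<le> i" "i < ?n + ?n" | "?n + ?n \<le> i" using that by linarith
    then show ?thesis
    proof cases
      case 2
      then show ?thesis
        by (intro disjI2 disjI1 exI[of _ "i - ?n"]) (auto simp: vs nth_append)
    next
      case 3
      with that show ?thesis
        by (intro disjI2 exI[of _ "i - (?n + ?n)"]) (auto simp: vs nth_append)
    qed (auto simp: vs nth_append)
  qed
  have len: "length vs = ?n + ?n + ?m" by (simp add: vs)
  note nn = nth_eq_iff_index_eq[OF G(3)] nth_eq_iff_index_eq[OF H(3)]
  show ?thesis
    unfolding graph_matrix_index[OF dist] len
  proof (rule eq_matI, goal_cases)
    case (1 i j)
    then have ij: "i < ?n + ?n + ?m" "j < ?n + ?n + ?m"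
      by (simp_all add: carrier_matD[OF ns_block_carrier[OF adj]])
    show ?case
      using part[OF ij(1)] part[OF ij(2)] ij
      by (elim disjE exE conjE)
        (simp_all add: ns_block_def Let_def adj_matrix_def usG wsH deg deg' nn irr edge_coeff_commute
          pair_graph_arc_commute[OF G(1)])
  qed (simp_all add: carrier_matD[OF ns_block_carrier[OF adj]])
qed

section \<open>Transfer of cospectrality from regular graphs to their NS joins\<close>

lemma map_mat_ns_block:
  assumes "A \<in> carrier_mat n n" "C \<in> carrier_mat m m"
  shows "map_mat complex_of_real (ns_block b a d g c f e A C)
    = ns_block (complex_of_real b) (complex_of_real a) (complex_of_real d) (complex_of_real g)
        (complex_of_real c) (complex_of_real f) (complex_of_real e)
        (map_mat complex_of_real A) (map_mat complex_of_real C)"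
  by (rule eq_matI) (use assms in \<open>auto simp: ns_block_def Let_def\<close>)

abbreviation cmat :: "real mat \<Rightarrow> complex mat" where
  "cmat \<equiv> map_mat complex_of_real"

lemma poly_char_poly_affine:
  fixes A :: "'a :: field mat"
  assumes A: "A \<in> carrier_mat n n"
  shows "poly (char_poly (\<alpha> \<cdot>\<^sub>m 1\<^sub>m n + \<beta> \<cdot>\<^sub>m A)) (\<alpha> + \<beta> * s) = \<beta> ^ n * poly (char_poly A) s"
proof -
  have M: "\<alpha> \<cdot>\<^sub>m 1\<^sub>m n + \<beta> \<cdot>\<^sub>m A \<in> carrier_mat n n" using A by simp
  have "(\<alpha> + \<beta> * s) \<cdot>\<^sub>m 1\<^sub>m n - (\<alpha> \<cdot>\<^sub>m 1\<^sub>m n + \<beta> \<cdot>\<^sub>m A) = \<beta> \<cdot>\<^sub>m (s \<cdot>\<^sub>m 1\<^sub>m n - A)"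
    by (rule eq_matI) (use A in \<open>auto simp: algebra_simps\<close>)
  then show ?thesis
    using A by (simp add: poly_char_poly[OF M] poly_char_poly[OF A])
qed

text \<open>Evaluating both sides of the hypothesis at \<open>\<alpha> + \<beta> * s\<close> and
  cancelling \<open>\<beta> ^ n\<close> compares the two polynomials at every
  \<open>s\<close>.\<close>

lemma char_poly_affine_cancel:
  fixes A B :: "complex mat"
  assumes A: "A \<in> carrier_mat n n" and B: "B \<in> carrier_mat n n" and "\<beta> \<noteq> 0"
    and eq: "char_poly (\<alpha> \<cdot>\<^sub>m 1\<^sub>m n + \<beta> \<cdot>\<^sub>m A) = char_poly (\<alpha> \<cdot>\<^sub>m 1\<^sub>m n + \<beta> \<cdot>\<^sub>m B)"
  shows "char_poly A = char_poly B"
proof (rule poly_ext)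
  fix s
  show "poly (char_poly A) s = poly (char_poly B) s"
    using poly_char_poly_affine[OF A, of \<alpha> \<beta> s] poly_char_poly_affine[OF B, of \<alpha> \<beta> s] eq \<open>\<beta> \<noteq> 0\<close>
    by simp
qed

lemma adj_matrix_carrier [simp]: "adj_matrix G vs \<in> carrier_mat (length vs) (length vs)"
  by (simp add: adj_matrix_def)

lemma graph_matrix_carrier [simp]: "graph_matrix X G vs \<in> carrier_mat (length vs) (length vs)"
  by (cases X) (auto simp: adj_matrix_def degree_diag_def Let_def)

lemma regular_0_no_arcs:
  assumes "pair_graph G" "regular 0 G"
  shows "(u, v) \<notin> parcs G"
proof
  assume a: "(u, v) \<in> parcs G"
  then have "u \<in> pverts G" using assms(1) by (auto simp: pair_graph_iff)
  then have "card {w. (u, w) \<in> parcs G} = 0"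
    using assms(2) by (auto simp: regular_def deg_card)
  then show False
    using a pair_graph_finite_nbrs[OF assms(1), of u] by auto
qed

lemma adj_matrix_regular_0:
  assumes "pair_graph G" "regular 0 G"
  shows "adj_matrix G vs = 0\<^sub>m (length vs) (length vs)"
proof (rule eq_matI)
  fix i j assume "i < dim_row (0\<^sub>m (length vs) (length vs) :: real mat)"
    "j < dim_col (0\<^sub>m (length vs) (length vs) :: real mat)"
  then have ij: "i < length vs" "j < length vs" by auto
  then show "adj_matrix G vs $$ (i, j) = 0\<^sub>m (length vs) (length vs) $$ (i, j)"
    using regular_0_no_arcs[OF assms(1,2)] by (auto simp: adj_matrix_def)
qed (simp_all add: adj_matrix_def)

text \<open>\<open>cospectral\<close> supplies just one matrix kind. As both graphs have degree
  \<open>r\<close>, that matrix is the same affine function of the adjacency matrix on both sides,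
  and the affine map can be undone.\<close>

lemma cospectral_regular_char_poly:
  assumes G: "pair_graph G" "regular r G" "distinct us" "set us = pverts G"
    and H: "pair_graph H" "regular r H" "distinct ws" "set ws = pverts H"
    and "cospectral G H"
  shows "length us = length ws"
    and "char_poly (cmat (adj_matrix G us)) = char_poly (cmat (adj_matrix H ws))"
proof -
  obtain X where "spectrum X G = spectrum X H"
    using \<open>cospectral G H\<close> by (auto simp: cospectral_def cospectral_wrt_def)
  then have "eigenvalue_mset (graph_matrix X G us) = eigenvalue_mset (graph_matrix X H ws)"
    by (simp only: spectrum_eq[OF G(3,4)] spectrum_eq[OF H(3,4)])
  then have eq: "char_poly (cmat (graph_matrix X G us)) = char_poly (cmat (graph_matrix X H ws))"
    by (subst (asm) eigenvalue_mset_eq_iff[OF graph_matrix_carrier graph_matrix_carrier])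
  have cm: "cmat (graph_matrix X G us) \<in> carrier_mat (length us) (length us)"
    "cmat (graph_matrix X H ws) \<in> carrier_mat (length ws) (length ws)" by simp_all
  show len: "length us = length ws"
    by (rule char_poly_eq_imp_dim_eq[OF cm eq])
  let ?n = "length us"
  have A: "cmat (adj_matrix G us) \<in> carrier_mat ?n ?n" "cmat (adj_matrix H ws) \<in> carrier_mat ?n ?n"
    using adj_matrix_carrier[of G us] adj_matrix_carrier[of H ws] by (simp_all add: len)
  have affine: "cmat (\<alpha> \<cdot>\<^sub>m 1\<^sub>m ?n + \<beta> \<cdot>\<^sub>m M)
      = complex_of_real \<alpha> \<cdot>\<^sub>m 1\<^sub>m ?n + complex_of_real \<beta> \<cdot>\<^sub>m cmat M"
    if "M \<in> carrier_mat ?n ?n" for M :: "real mat" and \<alpha> \<beta>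
    by (rule eq_matI) (use that in auto)
  show "char_poly (cmat (adj_matrix G us)) = char_poly (cmat (adj_matrix H ws))"
  \<comment> \<open>The coefficient vanishes only for the normalized Laplacian with
    \<open>r = 0\<close>; then both adjacency matrices are zero.\<close>
  proof (cases "edge_coeff X r r = 0")
    case True
    then have "r = 0" using edge_coeff_nonzero by blast
    then show ?thesis
      using adj_matrix_regular_0[OF G(1)] adj_matrix_regular_0[OF H(1)] G(2) H(2) len
      by simp
  next
    case False
    show ?thesis
    proof (rule char_poly_affine_cancel[OF A])
      show "complex_of_real (edge_coeff X r r) \<noteq> 0" using False by simp
      have adj: "adj_matrix G us \<in> carrier_mat ?n ?n" "adj_matrix H ws \<in> carrier_mat ?n ?n"
        using adj_matrix_carrier len by metis+
      show "char_poly (complex_of_real (diag_coeff X r) \<cdot>\<^sub>m 1\<^sub>m ?n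
            + complex_of_real (edge_coeff X r r) \<cdot>\<^sub>m cmat (adj_matrix G us))
          = char_poly (complex_of_real (diag_coeff X r) \<cdot>\<^sub>m 1\<^sub>m ?n
            + complex_of_real (edge_coeff X r r) \<cdot>\<^sub>m cmat (adj_matrix H ws))"
        using eq unfolding graph_matrix_regular[OF G(3,4,2)] graph_matrix_regular[OF H(3,4,2)]
          len[symmetric] affine[OF adj(1)] affine[OF adj(2)] .
    qed
  qed
qed

lemma cmat_adj_matrix_row:
  assumes "pair_graph G" "regular r G" "distinct vs" "set vs = pverts G" "i < length vs"
  shows "(\<Sum>j<length vs. cmat (adj_matrix G vs) $$ (i, j)) = of_nat r"
proof -
  have "(\<Sum>j<length vs. cmat (adj_matrix G vs) $$ (i, j))
      = (\<Sum>j<length vs. complex_of_real (adj_matrix G vs $$ (i, j)))"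
    using assms(5) by (intro sum.cong) (auto simp: adj_matrix_def)
  also have "\<dots> = of_nat (deg G (vs ! i))"
    using sum_adj_matrix_row[OF assms(1,3,4,5)] by (simp flip: of_real_sum)
  also have "deg G (vs ! i) = r"
    using assms nth_mem by (auto simp: regular_def)
  finally show ?thesis .
qed

lemma pair_graph_enum: "pair_graph G \<Longrightarrow> \<exists>vs. distinct vs \<and> set vs = pverts G"
  unfolding pair_graph_iff by (metis finite_distinct_list)

lemma cospectral_wrt_ns_join:
  assumes pg: "pair_graph G1" "pair_graph H1" "pair_graph G2" "pair_graph H2"
    and reg: "regular r1 G1" "regular r1 H1" "regular r2 G2" "regular r2 H2"
    and cos: "cospectral G1 H1" "cospectral G2 H2"
  shows "cospectral_wrt X (ns_join G1 G2) (ns_join H1 H2)"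
proof -
  obtain us where us: "distinct us" "set us = pverts G1" using pair_graph_enum[OF pg(1)] by auto
  obtain us' where us': "distinct us'" "set us' = pverts H1" using pair_graph_enum[OF pg(2)] by auto
  obtain ws where ws: "distinct ws" "set ws = pverts G2" using pair_graph_enum[OF pg(3)] by auto
  obtain ws' where ws': "distinct ws'" "set ws' = pverts H2" using pair_graph_enum[OF pg(4)] by auto
  define vs where "vs = map (Inl \<circ> Inl) us @ map Inr us @ map (Inl \<circ> Inr) ws"
  define vs' where "vs' = map (Inl \<circ> Inl) us' @ map Inr us' @ map (Inl \<circ> Inr) ws'"
  note c1 = cospectral_regular_char_poly[OF pg(1) reg(1) us pg(2) reg(2) us' cos(1)]
  note c2 = cospectral_regular_char_poly[OF pg(3) reg(3) ws pg(4) reg(4) ws' cos(2)]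
  \<comment> \<open>Common names for the orders make the coefficients of the two block matrices
    literally the same.\<close>
  define n m where "n = length us" and "m = length ws"
  have len: "length us = n" "length us' = n" "length ws = m" "length ws' = m"
    using c1(1) c2(1) by (auto simp: n_def m_def)
  have vs: "distinct vs" "set vs = pverts (ns_join G1 G2)"
    using us ws by (auto simp: vs_def pverts_ns_join distinct_map inj_on_def)
  have vs': "distinct vs'" "set vs' = pverts (ns_join H1 H2)"
    using us' ws' by (auto simp: vs'_def pverts_ns_join distinct_map inj_on_def)
  note M = graph_matrix_ns_join[OF pg(1) reg(1) us pg(3) reg(3) ws vs_def refl refl, of X,
      unfolded len]
  note M' = graph_matrix_ns_join[OF pg(2) reg(2) us' pg(4) reg(4) ws' vs'_def refl refl, of X,
      unfolded len]
  note car = adj_matrix_carrier[of G1 us, unfolded len] adj_matrix_carrier[of H1 us', unfolded len]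
    adj_matrix_carrier[of G2 ws, unfolded len] adj_matrix_carrier[of H2 ws', unfolded len]
  have ccar: "cmat L \<in> carrier_mat k k" if "L \<in> carrier_mat k k" for L k using that by simp
  have "char_poly (cmat (graph_matrix X (ns_join G1 G2) vs))
      = char_poly (cmat (graph_matrix X (ns_join H1 H2) vs'))"
    unfolding M M' map_mat_ns_block[OF car(1,3)] map_mat_ns_block[OF car(2,4)]
    by (rule char_poly_ns_block_cong[OF ccar[OF car(1)] ccar[OF car(2)] ccar[OF car(3)] ccar[OF car(4)]
          cmat_adj_matrix_row[OF pg(1) reg(1) us, unfolded len]
          cmat_adj_matrix_row[OF pg(2) reg(2) us', unfolded len]
          cmat_adj_matrix_row[OF pg(3) reg(3) ws, unfolded len]
          cmat_adj_matrix_row[OF pg(4) reg(4) ws', unfolded len] c1(2) c2(2)])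
  then show ?thesis
    unfolding cospectral_wrt_def spectrum_eq[OF vs] spectrum_eq[OF vs']
      eigenvalue_mset_def by (rule arg_cong[where f = proots])
qed

section \<open>Isomorphisms of NS joins\<close>

text \<open>\<open>digraph_iso\<close> also carries a map on arcs and new head and tail functions.
  Between pair graphs the arc map is forced by the vertex map, so an adjacency-preserving bijection
  of the vertices carries the same information.\<close>

lemma digraph_iso_pair_iff:
  assumes G: "pair_graph G" and H: "pair_graph H"
  shows "digraph_iso (with_proj G) (with_proj H) \<longleftrightarrow>
    (\<exists>f. bij_betw f (pverts G) (pverts H) \<and>
      (\<forall>u\<in>pverts G. \<forall>v\<in>pverts G. (u, v) \<in> parcs G \<longleftrightarrow> (f u, f v) \<in> parcs H))"
    (is "?iso \<longleftrightarrow> ?bij")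
proof
  have subG: "parcs G \<subseteq> pverts G \<times> pverts G" using G by (simp add: pair_graph_iff)
  assume ?iso
  then obtain h where h: "pre_digraph.digraph_isomorphism (with_proj G) h"
      "with_proj H = app_iso h (with_proj G)"
    by (auto simp: digraph_iso_def)
  let ?f = "iso_verts h"
  have inj: "inj_on ?f (pverts G)"
    using h(1) by (simp add: pre_digraph.digraph_isomorphism_def)
  have verts: "pverts H = ?f ` pverts G"
    using arg_cong[OF h(2), of verts] by simp
  have "iso_arcs h e = (?f (fst e), ?f (snd e))" if "e \<in> parcs G" for e
  proof (rule prod_eqI)
    show "fst (iso_arcs h e) = fst (?f (fst e), ?f (snd e))"
      using h(1) that fun_cong[OF arg_cong[OF h(2), of tail], of "iso_arcs h e"]
      by (simp add: pre_digraph.digraph_isomorphism_def)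
    show "snd (iso_arcs h e) = snd (?f (fst e), ?f (snd e))"
      using h(1) that fun_cong[OF arg_cong[OF h(2), of head], of "iso_arcs h e"]
      by (simp add: pre_digraph.digraph_isomorphism_def)
  qed
  then have "parcs H = (\<lambda>e. (?f (fst e), ?f (snd e))) ` parcs G"
    using arg_cong[OF h(2), of arcs] by simp
  then have im: "parcs H = map_prod ?f ?f ` parcs G"
    by (simp add: map_prod_def case_prod_unfold)
  have "(u, v) \<in> parcs G \<longleftrightarrow> (?f u, ?f v) \<in> parcs H" if uv: "u \<in> pverts G" "v \<in> pverts G" for u v
  proof
    assume "(?f u, ?f v) \<in> parcs H"
    then obtain x y where xy: "(x, y) \<in> parcs G" "?f u = ?f x" "?f v = ?f y"
      unfolding im by auto
    moreover have "x \<in> pverts G" "y \<in> pverts G" using xy(1) subG by auto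
    ultimately show "(u, v) \<in> parcs G" using inj_onD[OF inj] uv by metis
  qed (auto simp: im)
  then show ?bij
    using inj verts by (auto simp: bij_betw_def)
next
  assume ?bij
  then obtain f where f: "bij_betw f (pverts G) (pverts H)"
    and arcs: "\<And>u v. u \<in> pverts G \<Longrightarrow> v \<in> pverts G \<Longrightarrow> (u, v) \<in> parcs G \<longleftrightarrow> (f u, f v) \<in> parcs H"
    by auto
  have sub: "parcs G \<subseteq> pverts G \<times> pverts G" "parcs H \<subseteq> pverts H \<times> pverts H"
    using G H by (simp_all add: pair_graph_iff)
  interpret G: pair_graph G by (rule G)
  define h where "h = \<lparr>iso_verts = f, iso_arcs = map_prod f f, iso_head = snd, iso_tail = fst\<rparr>"
  have inj: "inj_on f (pverts G)" and im: "f ` pverts G = pverts H"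
    using f by (auto simp: bij_betw_def)
  have "inj_on (map_prod f f) (parcs G)"
    by (rule inj_on_subset[OF map_prod_inj_on[OF inj inj] sub(1)])
  then have "pre_digraph.digraph_isomorphism (with_proj G) h"
    using inj G.wf_digraph by (simp add: pre_digraph.digraph_isomorphism_def h_def)
  moreover have "map_prod f f ` parcs G = parcs H"
  proof (intro equalityI subsetI)
    fix e assume e: "e \<in> parcs H"
    then obtain u v where "e = (f u, f v)" "u \<in> pverts G" "v \<in> pverts G"
      using sub(2) im by (cases e) blast
    then show "e \<in> map_prod f f ` parcs G" using arcs e by (auto intro: rev_image_eqI[of "(u, v)"])
  qed (use sub(1) arcs in auto)
  then have "with_proj H = app_iso h (with_proj G)"
    by (intro pre_digraph.equality) (simp_all add: h_def im)
  ultimately show ?iso by (auto simp: digraph_iso_def)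
qed

lemma deg_bij:
  assumes G: "pair_graph G" and H: "pair_graph H" and f: "bij_betw f (pverts G) (pverts H)"
    and arcs: "\<And>u v. u \<in> pverts G \<Longrightarrow> v \<in> pverts G \<Longrightarrow> (u, v) \<in> parcs G \<longleftrightarrow> (f u, f v) \<in> parcs H"
    and v: "v \<in> pverts G"
  shows "deg H (f v) = deg G v"
proof -
  have sub: "parcs G \<subseteq> pverts G \<times> pverts G" "parcs H \<subseteq> pverts H \<times> pverts H"
    using G H by (simp_all add: pair_graph_iff)
  have inj: "inj_on f (pverts G)" and im: "f ` pverts G = pverts H"
    using f by (auto simp: bij_betw_def)
  have "{w. (f v, w) \<in> parcs H} = f ` {w. (v, w) \<in> parcs G}"
  proof (intro equalityI subsetI)
    fix y assume "y \<in> {w. (f v, w) \<in> parcs H}"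
    then have y: "(f v, y) \<in> parcs H" by simp
    then obtain w where "w \<in> pverts G" "y = f w" using sub(2) im by blast
    then show "y \<in> f ` {w. (v, w) \<in> parcs G}" using arcs[OF v] y by simp
  qed (use sub(1) arcs[OF v] in auto)
  moreover have "inj_on f {w. (v, w) \<in> parcs G}"
    by (rule inj_on_subset[OF inj]) (use sub in auto)
  ultimately show ?thesis by (simp add: deg_card card_image)
qed

lemma deg_less_card:
  assumes "pair_graph G" "v \<in> pverts G"
  shows "deg G v < card (pverts G)"
  unfolding deg_card
  by (rule psubset_card_mono) (use assms in \<open>auto simp: pair_graph_iff irrefl_def\<close>)

text \<open>Old vertices have larger degree: those of \<open>G\<close> have
  \<open>2 * r + card (pverts H)\<close> with \<open>H\<close> nonempty, and those of
  \<open>H\<close> have at least \<open>card (pverts G)\<close>, which exceeds \<open>r\<close>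
  because \<open>G\<close> has no loops.\<close>

lemma deg_ns_join_eq_iff:
  assumes "pair_graph G" "pair_graph H" "regular r G" "pverts G \<noteq> {}" "pverts H \<noteq> {}"
    and x: "x \<in> pverts (ns_join G H)"
  shows "deg (ns_join G H) x = r \<longleftrightarrow> (\<exists>u. x = Inr u)"
proof -
  have c: "card (pverts H) > 0" using assms(2,5) by (auto simp: pair_graph_iff card_gt_0_iff)
  obtain u where "u \<in> pverts G" using assms(4) by auto
  then have "r < card (pverts G)"
    using deg_less_card[OF assms(1)] assms(3) by (auto simp: regular_def)
  note r = this
  consider u where "x = Inl (Inl u)" "u \<in> pverts G" | y where "x = Inl (Inr y)" "y \<in> pverts H"
    | u where "x = Inr u" "u \<in> pverts G"
    using x by (auto simp: pverts_ns_join)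
  then show ?thesis
  proof cases
    case 1
    then show ?thesis using deg_ns_join_Inl_Inl[OF assms(1,2)] assms(3) c by (simp add: regular_def)
  next
    case 2
    then show ?thesis using deg_ns_join_Inl_Inr[OF assms(1,2)] r by simp
  next
    case 3
    then show ?thesis using assms(3) by (simp add: deg_ns_join_Inr regular_def)
  qed
qed

lemma digraph_iso_ns_join_cancel:
  fixes G1 :: "'a pair_pre_digraph" and H1 :: "'b pair_pre_digraph"
    and G2 :: "'c pair_pre_digraph" and H2 :: "'d pair_pre_digraph"
  assumes pg: "pair_graph G1" "pair_graph H1" "pair_graph G2" "pair_graph H2"
    and reg: "regular r G1" "regular r H1"
    and card: "card (pverts G1) = card (pverts H1)" "card (pverts G2) = card (pverts H2)"
    and iso: "digraph_iso (with_proj (ns_join G1 G2)) (with_proj (ns_join H1 H2))"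
  shows "digraph_iso (with_proj G2) (with_proj H2)"
proof (cases "pverts G2 = {} \<or> pverts H2 = {}")
  case True
  then have "pverts G2 = {}" "pverts H2 = {}" using card(2) pg by (auto simp: pair_graph_iff)
  then show ?thesis by (simp add: digraph_iso_pair_iff[OF pg(3,4)] bij_betw_def)
next
  case False
  let ?J = "ns_join G1 G2" and ?K = "ns_join H1 H2"
  have pgJ: "pair_graph ?J" and pgK: "pair_graph ?K"
    using pg by (auto intro: pair_graph_ns_join)
  obtain \<phi> where \<phi>: "bij_betw \<phi> (pverts ?J) (pverts ?K)"
    and arcs: "\<And>x y. x \<in> pverts ?J \<Longrightarrow> y \<in> pverts ?J \<Longrightarrow> (x, y) \<in> parcs ?J \<longleftrightarrow> (\<phi> x, \<phi> y) \<in> parcs ?K"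
    using iso unfolding digraph_iso_pair_iff[OF pgJ pgK] by blast
  have inj: "inj_on \<phi> (pverts ?J)" and im: "\<phi> ` pverts ?J = pverts ?K"
    using \<phi> by (auto simp: bij_betw_def)
  have verts: "Inl (Inl u) \<in> pverts ?J \<longleftrightarrow> u \<in> pverts G1" "Inl (Inr y) \<in> pverts ?J \<longleftrightarrow> y \<in> pverts G2"
    "Inr u \<in> pverts ?J \<longleftrightarrow> u \<in> pverts G1" "Inl (Inl u') \<in> pverts ?K \<longleftrightarrow> u' \<in> pverts H1"
    "Inl (Inr y') \<in> pverts ?K \<longleftrightarrow> y' \<in> pverts H2" "Inr u' \<in> pverts ?K \<longleftrightarrow> u' \<in> pverts H1" for u y u' y'
    by (auto simp: pverts_ns_join)
  \<comment> \<open>Isomorphisms preserve degrees, and the degree \<open>r\<close> characterises the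
    new vertices on both sides. If \<open>G1\<close> is empty, there are none.\<close>
  have new: "(\<exists>u. \<phi> x = Inr u) \<longleftrightarrow> (\<exists>u. x = Inr u)" if x: "x \<in> pverts ?J" for x
  proof (cases "pverts G1 = {}")
    case True
    then have "pverts H1 = {}" using card(1) pg(2) by (simp add: pair_graph_iff)
    moreover have "\<phi> x \<in> pverts ?K" using im x by auto
    ultimately show ?thesis using True x by (auto simp: pverts_ns_join)
  next
    case ne: False
    then have "pverts H1 \<noteq> {}" using card(1) pg(1) by (auto simp: pair_graph_iff)
    moreover have "\<phi> x \<in> pverts ?K" using im x by auto
    ultimately show ?thesis
      using deg_ns_join_eq_iff[OF pg(1,3) reg(1) ne _ x] deg_ns_join_eq_iff[OF pg(2,4) reg(2), of "\<phi> x"]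
        deg_bij[OF pgJ pgK \<phi> arcs x] False by auto
  qed
  \<comment> \<open>It suffices to embed \<open>G2\<close> into the first join as an induced
    subgraph that \<open>\<phi>\<close> carries into \<open>H2\<close>: the resulting injection is
    bijective since the orders agree.\<close>
  have reduce: ?thesis
    if g: "\<And>v. v \<in> pverts G2 \<Longrightarrow> g v \<in> pverts ?J" "inj_on g (pverts G2)"
      "\<And>v w. v \<in> pverts G2 \<Longrightarrow> w \<in> pverts G2 \<Longrightarrow> (g v, g w) \<in> parcs ?J \<longleftrightarrow> (v, w) \<in> parcs G2"
      "\<And>v. v \<in> pverts G2 \<Longrightarrow> \<exists>y. \<phi> (g v) = Inl (Inr y)" for g
  proof -
    obtain \<psi> where \<psi>: "\<And>v. v \<in> pverts G2 \<Longrightarrow> \<phi> (g v) = Inl (Inr (\<psi> v))"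
      using g(4) by metis
    have "inj_on \<psi> (pverts G2)"
      using g(1,2) inj \<psi> by (metis (no_types, lifting) inj_on_def)
    moreover have "\<psi> ` pverts G2 \<subseteq> pverts H2"
      using g(1) \<psi> im verts(5) by (metis image_eqI image_subsetI)
    ultimately have "bij_betw \<psi> (pverts G2) (pverts H2)"
      using card(2) pg(4) by (metis bij_betw_def card_image card_subset_eq pair_graph_iff)
    moreover have "(v, w) \<in> parcs G2 \<longleftrightarrow> (\<psi> v, \<psi> w) \<in> parcs H2" if "v \<in> pverts G2" "w \<in> pverts G2" for v w
      using g(3)[OF that] arcs[OF g(1)[OF that(1)] g(1)[OF that(2)]] \<psi> that by simp
    ultimately show ?thesis unfolding digraph_iso_pair_iff[OF pg(3,4)] by blast
  qed
  have old: "\<exists>z'. \<phi> (Inl z) = Inl z'" if "Inl z \<in> pverts ?J" for z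
    using new[OF that] by (cases "\<phi> (Inl z)") auto
  show ?thesis
  proof (cases "\<forall>v\<in>pverts G2. \<exists>y. \<phi> (Inl (Inr v)) = Inl (Inr y)")
    case True
    then show ?thesis
      by (intro reduce[of "Inl \<circ> Inr"]) (auto simp: verts inj_on_def)
  next
    case False
    then obtain v0 where v0: "v0 \<in> pverts G2" "\<nexists>y. \<phi> (Inl (Inr v0)) = Inl (Inr y)" by auto
    have v0J: "Inl (Inr v0) \<in> pverts ?J" using v0 verts by simp
    obtain x0 where x0: "\<phi> (Inl (Inr v0)) = Inl (Inl x0)"
      using old[OF v0J] v0(2) by (metis sum.exhaust)
    then have x0H: "x0 \<in> pverts H1" using v0J im verts(4) by (metis imageI)
    \<comment> \<open>A neighbour \<open>w\<close> of \<open>x0\<close> would make the new vertex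
      \<open>Inr w\<close> adjacent to the image of \<open>v0\<close>. Its preimage is a new vertex,
      and those are never adjacent to vertices of \<open>G2\<close>.\<close>
    have "r = 0"
    proof (rule ccontr)
      assume "r \<noteq> 0"
      then have "card {w. (x0, w) \<in> parcs H1} \<noteq> 0"
        using reg(2) x0H by (auto simp: regular_def deg_card)
      then obtain w where w: "(x0, w) \<in> parcs H1" by (metis card.empty empty_Collect_eq)
      then have "w \<in> pverts H1" using pg(2) by (auto simp: pair_graph_iff)
      then obtain x where x: "x \<in> pverts ?J" "\<phi> x = Inr w" using im verts(6) by (metis imageE)
      then obtain u where "x = Inr u" using new by auto
      then show False
        using arcs[OF x(1) v0J] x(2) x0 w pair_graph_arc_commute[OF pg(2)] by simp
    qed
    then have noG: "(x, y) \<notin> parcs G1" and noH: "(x', y') \<notin> parcs H1" for x y x' y'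
      using regular_0_no_arcs pg(1,2) reg by metis+
    \<comment> \<open>\<open>u\<close> is adjacent to \<open>v0\<close>, so its image is an old
      vertex adjacent to \<open>x0\<close>; as \<open>H1\<close> has no edges, the image lies in
      \<open>H2\<close>.\<close>
    have swap: "\<exists>y. \<phi> (Inl (Inl u)) = Inl (Inr y)" if u: "u \<in> pverts G1" for u
    proof -
      have uJ: "Inl (Inl u) \<in> pverts ?J" using u verts by simp
      then have "(\<phi> (Inl (Inl u)), Inl (Inl x0)) \<in> parcs ?K"
        using arcs[OF uJ v0J] u v0(1) x0 by simp
      then show ?thesis using old[OF uJ] noH by (metis arcs_ns_join(1) sum.exhaust)
    qed
    \<comment> \<open>Any bijection serves, since both graphs are edgeless.\<close>
    obtain \<beta> where \<beta>: "bij_betw \<beta> (pverts H1) (pverts G1)"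
      using finite_same_card_bij[of "pverts H1" "pverts G1"] card(1) pg(1,2)
      by (auto simp: pair_graph_iff)
    \<comment> \<open>The vertices of \<open>H1\<close> and the images of those of \<open>G1\<close> now form two disjoint independent sets,
      each completely joined to all other old vertices, so they can be exchanged.\<close>
    define g :: "'c \<Rightarrow> ('a + 'c) + 'a" where
      "g v = (case projl (\<phi> (Inl (Inr v))) of Inl x \<Rightarrow> Inl (Inl (\<beta> x)) | Inr y \<Rightarrow> Inl (Inr v))" for v
    have g: "(\<exists>y\<in>pverts H2. \<phi> (Inl (Inr v)) = Inl (Inr y) \<and> g v = Inl (Inr v))
        \<or> (\<exists>x\<in>pverts H1. \<phi> (Inl (Inr v)) = Inl (Inl x) \<and> g v = Inl (Inl (\<beta> x)) \<and> \<beta> x \<in> pverts G1)"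
      if v: "v \<in> pverts G2" for v
    proof -
      have vJ: "Inl (Inr v) \<in> pverts ?J" using v verts by simp
      obtain z where z: "\<phi> (Inl (Inr v)) = Inl z" using old[OF vJ] by auto
      then have "Inl z \<in> pverts ?K" using im vJ by (metis imageI)
      then show ?thesis
        using z bij_betwE[OF \<beta>] by (cases z) (auto simp: verts g_def)
    qed
    show ?thesis
    proof (rule reduce[of g])
      show "g v \<in> pverts ?J" if "v \<in> pverts G2" for v
        using g[OF that] that by (auto simp: verts)
      show "inj_on g (pverts G2)"
      proof (rule inj_onI)
        fix v w assume vw: "v \<in> pverts G2" "w \<in> pverts G2" "g v = g w"
        have "\<phi> (Inl (Inr v)) = \<phi> (Inl (Inr w)) \<or> v = w"
          using g[OF vw(1)] g[OF vw(2)] vw(3) bij_betw_imp_inj_on[OF \<beta>] by (auto dest: inj_onD)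
        then show "v = w"
          using inj_onD[OF inj, of "Inl (Inr v)" "Inl (Inr w)"] vw verts by auto
      qed
      \<comment> \<open>If both images lie in \<open>H2\<close>, nothing is moved. If both lie in
        \<open>H1\<close>, neither pair is adjacent; if exactly one does, both pairs are adjacent
        through the join.\<close>
      show "(g v, g w) \<in> parcs ?J \<longleftrightarrow> (v, w) \<in> parcs G2" if vw: "v \<in> pverts G2" "w \<in> pverts G2" for v w
        using g[OF vw(1)] g[OF vw(2)] arcs[of "Inl (Inr v)" "Inl (Inr w)"] vw
        by (elim disjE bexE conjE) (simp_all add: verts noG noH)
      show "\<exists>y. \<phi> (g v) = Inl (Inr y)" if "v \<in> pverts G2" for v
        using g[OF that] swap by auto
    qed
  qed
qed

lemma cospectral_regular_card:
  assumes "pair_graph G" "regular r G" "pair_graph H" "regular r H" "cospectral G H"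
  shows "card (pverts G) = card (pverts H)"
proof -
  obtain us where us: "distinct us" "set us = pverts G" using pair_graph_enum[OF assms(1)] by auto
  obtain ws where ws: "distinct ws" "set ws = pverts H" using pair_graph_enum[OF assms(3)] by auto
  show ?thesis
    using cospectral_regular_char_poly(1)[OF assms(1,2) us assms(3,4) ws assms(5)] us ws
    by (metis distinct_card)
qed

theorem corollary5p2:
  fixes G1 :: "'a pair_pre_digraph" and H1 :: "'b pair_pre_digraph"
    and G2 :: "'c pair_pre_digraph" and H2 :: "'d pair_pre_digraph"
    and r1 r2 :: nat
  assumes "pair_graph G1" and "pair_graph H1" and "pair_graph G2" and "pair_graph H2"
    and "regular r1 G1" and "regular r1 H1" and "regular r2 G2" and "regular r2 H2"
    and "cospectral G1 H1"
    and "cospectral G2 H2" and "\<not> digraph_iso (with_proj G2) (with_proj H2)"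
  shows "NICS {Adjacency, Laplacian, Signless_Laplacian, Normalized_Laplacian}
           (ns_join G1 G2) (ns_join H1 H2)"
proof -
  have card: "card (pverts G1) = card (pverts H1)" "card (pverts G2) = card (pverts H2)"
    using cospectral_regular_card assms by metis+
  show ?thesis
    unfolding NICS_def
    using digraph_iso_ns_join_cancel[OF assms(1-6) card] cospectral_wrt_ns_join[OF assms(1-10)]
      assms by blast
qed

end
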